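(* Let $G$ be a Dehn Monster. Then for any finite generating set $S$ of $G$ the skeleton $X_{G,S}$ is effective, but no configuration in $X_{G,S}$ is computable.
   Context: All generating sets $S$ are finite, symmetric ($S=S^{-1}$) and do not contain the identity $1_G$. For $w\in S^*$, $\overline{w}\in G$ is the element represented by $w$; a factor is a finite contiguous subword. The skeleton is $X_{G,S}=\{x\in S^{\mathbb{Z}} : \overline{w}\neq 1_G \text{ for every nonempty finite factor } w \text{ of } x\}$. For a set $\mathcal{F}$ of finite words over a finite alphabet $A$, $\mathcal{X}_{\mathcal{F}}$ is the set of $x\in A^{\mathbb{Z}}$ having no factor in $\mathcal{F}$; a subshift is effective if it equals $\mathcal{X}_{\mathcal{F}}$ for some decidable $\mathcal{F}$. A configuration $x\in S^{\mathbb{Z}}$ is computable if there is an algorithm that on input $n\in\mathbb{Z}$ outputs $x_n\in S$. A group is recursively presented if it has a presentation $\langle S\mid R\rangle$ with $S$ finite and $R$ recursively enumerable. A finitely generated group $G$ with generating set $S$ is algorithmically finite if for every infinite recursively enumerable set $L\subseteq\mathbb{F}_S$ (the free group on $S$) there exist infinitely many pairs of distinct words $u,v\in L$ with $\pi(u)=\pi(v)$, where $\pi:\mathbb{F}_S\to G$ is the canonical projection; this property does not depend on the generating set. A Dehn Monster is a finitely generated group that is infinite, recursively presented and algorithmically finite. *)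

theory Defs
  imports
    "HOL-Algebra.Generated_Groups"
    "HOL-Library.Nat_Bijection"
    "HOL-Library.Countable_Set"
begin

section \<open>Computability\<close>

text \<open>
  The total recursive functions: the least class containing the zero, successor and projection
  functions that is closed under composition, primitive recursion and minimisation of regular
  functions. A function of arity \<open>k\<close> is a map on lists of which only the values on lists
  of length \<open>k\<close> are meaningful. In a primitive recursion the recursion variable is the
  first argument, and the step function receives the recursion variable, the previous value and
  the parameters, in this order.
\<close>

inductive mu_recursive :: "nat \<Rightarrow> (nat list \<Rightarrow> nat) \<Rightarrow> bool" where
  zero: "mu_recursive k (\<lambda>xs. 0)"
| succ: "mu_recursive 1 (\<lambda>xs. Suc (xs ! 0))"
| proj: "i < k \<Longrightarrow> mu_recursive k (\<lambda>xs. xs ! i)"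
| comp: "mu_recursive (length gs) f \<Longrightarrow> (\<And>g. g \<in> set gs \<Longrightarrow> mu_recursive k g)
    \<Longrightarrow> mu_recursive k (\<lambda>xs. f (map (\<lambda>g. g xs) gs))"
| prim: "mu_recursive k f \<Longrightarrow> mu_recursive (Suc (Suc k)) g
    \<Longrightarrow> mu_recursive (Suc k)
          (\<lambda>xs. rec_nat (f (tl xs)) (\<lambda>y r. g (y # r # tl xs)) (hd xs))"
| mini: "mu_recursive (Suc k) f \<Longrightarrow> (\<And>xs. length xs = k \<Longrightarrow> \<exists>y. f (y # xs) = 0)
    \<Longrightarrow> mu_recursive k (\<lambda>xs. LEAST y. f (y # xs) = 0)"

definition computable_fun :: "(nat \<Rightarrow> nat) \<Rightarrow> bool" where
  "computable_fun f \<longleftrightarrow> (\<exists>F. mu_recursive 1 F \<and> (\<forall>n. f n = F [n]))"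

definition decidable_set :: "nat set \<Rightarrow> bool" where
  "decidable_set A \<longleftrightarrow> computable_fun (\<lambda>n. if n \<in> A then 1 else 0)"

definition re_set :: "nat set \<Rightarrow> bool" where
  "re_set A \<longleftrightarrow> A = {} \<or> (\<exists>f. computable_fun f \<and> A = range f)"

text \<open>
  For a finite alphabet \<open>A\<close>, \<^term>\<open>to_nat_on A\<close> is a bijection from \<open>A\<close> onto
  \<open>{..<card A}\<close>. Which bijection is chosen is immaterial, since any two differ by a
  permutation of \<open>{..<card A}\<close>, which is computable.
\<close>

definition word_code :: "'a set \<Rightarrow> 'a list \<Rightarrow> nat" where
  "word_code A w = list_encode (map (to_nat_on A) w)"

lemma inj_on_word_code:
  assumes "countable A"
  shows "inj_on (word_code A) (lists A)"
proof (rule inj_onI)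
  fix u v
  assume uv: "u \<in> lists A" "v \<in> lists A" and eq: "word_code A u = word_code A v"
  have "map (to_nat_on A) u = map (to_nat_on A) v"
    using eq by (simp add: word_code_def list_encode_eq)
  moreover have "inj_on (to_nat_on A) (set u \<union> set v)"
    by (rule inj_on_subset[OF inj_on_to_nat_on[OF assms]]) (use uv in auto)
  ultimately show "u = v"
    by (rule map_inj_on)
qed

definition decidable_words :: "'a set \<Rightarrow> 'a list set \<Rightarrow> bool" where
  "decidable_words A F \<longleftrightarrow> finite A \<and> F \<subseteq> lists A \<and> decidable_set (word_code A ` F)"

definition re_words :: "'a set \<Rightarrow> 'a list set \<Rightarrow> bool" where
  "re_words A L \<longleftrightarrow> finite A \<and> L \<subseteq> lists A \<and> re_set (word_code A ` L)"


section \<open>Free groups and presentations\<close>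

text \<open>
  The free group with basis \<open>S\<close> consists of the reduced words over
  \<open>S \<times> {True, False}\<close>; the letter \<open>(s, True)\<close> stands for \<open>s\<close> and
  \<open>(s, False)\<close> for its formal inverse. If \<open>S\<close> is a subset of a group, then
  \<open>(s, False)\<close> is unrelated to the letter \<open>(t, True)\<close> where \<open>t\<close> is the inverse
  of \<open>s\<close> in that group.
\<close>

abbreviation letters :: "'a set \<Rightarrow> ('a \<times> bool) set" where
  "letters S \<equiv> S \<times> UNIV"

definition flip :: "'a \<times> bool \<Rightarrow> 'a \<times> bool" where
  "flip x = (fst x, \<not> snd x)"

definition reduced :: "('a \<times> bool) list \<Rightarrow> bool" where
  "reduced w \<longleftrightarrow> successively (\<lambda>x y. y \<noteq> flip x) w"

fun cancel_cons :: "'a \<times> bool \<Rightarrow> ('a \<times> bool) list \<Rightarrow> ('a \<times> bool) list" where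
  "cancel_cons x [] = [x]"
| "cancel_cons x (y # w) = (if y = flip x then w else x # y # w)"

definition free_group :: "'a set \<Rightarrow> ('a \<times> bool) list monoid" where
  "free_group S =
     \<lparr>carrier = {w \<in> lists (letters S). reduced w},
      monoid.mult = (\<lambda>u v. foldr cancel_cons u v),
      one = []\<rparr>"

lemma flip_flip [simp]: "flip (flip x) = x"
  by (simp add: flip_def)

lemma reduced_cancel_cons: "reduced w \<Longrightarrow> reduced (cancel_cons x w)"
  by (cases w) (auto simp: reduced_def successively_Cons)

lemma reduced_foldr_cancel_cons: "reduced w \<Longrightarrow> reduced (foldr cancel_cons u w)"
  by (induction u) (auto simp: reduced_cancel_cons)

lemma cancel_cons_flip:
  assumes "reduced w"
  shows "cancel_cons x (cancel_cons (flip x) w) = w"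
proof (cases w)
  case (Cons y v)
  with assms show ?thesis by (cases v) (auto simp: reduced_def)
qed simp

lemma set_cancel_cons: "set (cancel_cons x w) \<subseteq> insert x (set w)"
  by (cases w) auto

lemma set_foldr_cancel_cons: "set (foldr cancel_cons u w) \<subseteq> set u \<union> set w"
  using set_cancel_cons by (induction u) fastforce+

lemma foldr_cancel_cons_cancel_cons:
  assumes "reduced w"
  shows "foldr cancel_cons (cancel_cons x v) w = cancel_cons x (foldr cancel_cons v w)"
  by (cases v) (auto simp: cancel_cons_flip reduced_foldr_cancel_cons assms)

lemma foldr_cancel_cons_assoc:
  assumes "reduced w"
  shows "foldr cancel_cons (foldr cancel_cons u v) w = foldr cancel_cons u (foldr cancel_cons v w)"
  by (induction u) (auto simp: foldr_cancel_cons_cancel_cons assms)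

lemma foldr_cancel_cons_Nil: "reduced w \<Longrightarrow> foldr cancel_cons w [] = w"
proof (induction w)
  case (Cons x w)
  then show ?case by (cases w) (auto simp: reduced_def)
qed simp

lemma foldr_cancel_cons_inverse:
  "reduced w \<Longrightarrow> foldr cancel_cons (rev (map flip u)) (foldr cancel_cons u w) = w"
proof (induction u arbitrary: w)
  case (Cons x u)
  then show ?case
    using cancel_cons_flip[of "foldr cancel_cons u w" "flip x"]
    by (simp add: reduced_foldr_cancel_cons)
qed simp

lemma group_free_group: "group (free_group S)"
proof (rule groupI)
  fix u assume u: "u \<in> carrier (free_group S)"
  let ?v = "foldr cancel_cons (rev (map flip u)) []"
  have "set (rev (map flip u)) \<subseteq> letters S"
    using u by (auto simp: free_group_def flip_def)
  then have "set ?v \<subseteq> letters S"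
    using set_foldr_cancel_cons[of "rev (map flip u)" "[]"] by auto
  then have "?v \<in> carrier (free_group S)"
    using reduced_foldr_cancel_cons[of "[]"] by (auto simp: free_group_def reduced_def)
  moreover have "foldr cancel_cons ?v u = []"
  proof -
    have red: "reduced u" "reduced []"
      using u by (auto simp: free_group_def reduced_def)
    have "foldr cancel_cons ?v u = foldr cancel_cons (rev (map flip u)) (foldr cancel_cons u [])"
      using red by (simp add: foldr_cancel_cons_assoc foldr_cancel_cons_Nil)
    then show ?thesis
      using foldr_cancel_cons_inverse[OF red(2)] by simp
  qed
  ultimately show "\<exists>v\<in>carrier (free_group S). v \<otimes>\<^bsub>free_group S\<^esub> u = \<one>\<^bsub>free_group S\<^esub>"
    by (auto simp: free_group_def)
next
  fix u v assume "u \<in> carrier (free_group S)" "v \<in> carrier (free_group S)"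
  then show "u \<otimes>\<^bsub>free_group S\<^esub> v \<in> carrier (free_group S)"
    using set_foldr_cancel_cons[of u v]
    by (auto simp: free_group_def reduced_foldr_cancel_cons)
qed (auto simp: free_group_def foldr_cancel_cons_assoc reduced_def)

definition normal_closure :: "('a, 'b) monoid_scheme \<Rightarrow> 'a set \<Rightarrow> 'a set" where
  "normal_closure G R = generate G {g \<otimes>\<^bsub>G\<^esub> r \<otimes>\<^bsub>G\<^esub> inv\<^bsub>G\<^esub> g | g r. g \<in> carrier G \<and> r \<in> R}"

definition presented_group :: "'a set \<Rightarrow> ('a \<times> bool) list set \<Rightarrow> ('a \<times> bool) list set monoid" where
  "presented_group S R = free_group S Mod normal_closure (free_group S) R"

text \<open>
  The generating symbols of a presentation are abstract, so that a finite set of them may be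
  taken to be a set of natural numbers.
\<close>

definition recursively_presented :: "('a, 'b) monoid_scheme \<Rightarrow> bool" where
  "recursively_presented G \<longleftrightarrow>
     (\<exists>(S :: nat set) R. finite S \<and> R \<subseteq> carrier (free_group S) \<and> re_words (letters S) R
        \<and> G \<cong> presented_group S R)"


section \<open>Dehn monsters\<close>

definition generating_set :: "('a, 'b) monoid_scheme \<Rightarrow> 'a set \<Rightarrow> bool" where
  "generating_set G S \<longleftrightarrow>
     finite S \<and> S \<subseteq> carrier G \<and> (\<lambda>s. inv\<^bsub>G\<^esub> s) ` S = S \<and> \<one>\<^bsub>G\<^esub> \<notin> S
     \<and> generate G S = carrier G"

text \<open>The canonical projection from the free group with basis \<open>S \<subseteq> carrier G\<close> to \<open>G\<close>.\<close>

definition free_proj :: "('a, 'b) monoid_scheme \<Rightarrow> ('a \<times> bool) list \<Rightarrow> 'a" where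
  "free_proj G w =
     foldr (\<lambda>(s, b) g. (if b then s else inv\<^bsub>G\<^esub> s) \<otimes>\<^bsub>G\<^esub> g) w \<one>\<^bsub>G\<^esub>"

definition algorithmically_finite_wrt :: "('a, 'b) monoid_scheme \<Rightarrow> 'a set \<Rightarrow> bool" where
  "algorithmically_finite_wrt G S \<longleftrightarrow>
     (\<forall>L. L \<subseteq> carrier (free_group S) \<and> infinite L \<and> re_words (letters S) L \<longrightarrow>
        infinite {(u, v). u \<in> L \<and> v \<in> L \<and> u \<noteq> v \<and> free_proj G u = free_proj G v})"

text \<open>
  Algorithmic finiteness does not depend on the generating set; the existential is the weaker
  of the two possible readings.
\<close>

definition algorithmically_finite :: "('a, 'b) monoid_scheme \<Rightarrow> bool" where
  "algorithmically_finite G \<longleftrightarrow> (\<exists>S. generating_set G S \<and> algorithmically_finite_wrt G S)"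

definition Dehn_monster :: "('a, 'b) monoid_scheme \<Rightarrow> bool" where
  "Dehn_monster G \<longleftrightarrow>
     group G \<and> (\<exists>S. generating_set G S) \<and> infinite (carrier G)
     \<and> recursively_presented G \<and> algorithmically_finite G"


section \<open>Subshifts and skeletons\<close>

definition word_value :: "('a, 'b) monoid_scheme \<Rightarrow> 'a list \<Rightarrow> 'a" where
  "word_value G w = foldr (\<lambda>s g. s \<otimes>\<^bsub>G\<^esub> g) w \<one>\<^bsub>G\<^esub>"

definition full_shift :: "'a set \<Rightarrow> (int \<Rightarrow> 'a) set" where
  "full_shift A = {x. range x \<subseteq> A}"

definition factors :: "(int \<Rightarrow> 'a) \<Rightarrow> 'a list set" where
  "factors x = {map (\<lambda>j. x (i + int j)) [0..<n] | i n. True}"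

definition avoiding_shift :: "'a set \<Rightarrow> 'a list set \<Rightarrow> (int \<Rightarrow> 'a) set" where
  "avoiding_shift A F = {x \<in> full_shift A. factors x \<inter> F = {}}"

definition effective_subshift :: "'a set \<Rightarrow> (int \<Rightarrow> 'a) set \<Rightarrow> bool" where
  "effective_subshift A X \<longleftrightarrow> (\<exists>F. decidable_words A F \<and> X = avoiding_shift A F)"

definition skeleton :: "('a, 'b) monoid_scheme \<Rightarrow> 'a set \<Rightarrow> (int \<Rightarrow> 'a) set" where
  "skeleton G S =
     {x \<in> full_shift S. \<forall>w \<in> factors x. w \<noteq> [] \<longrightarrow> word_value G w \<noteq> \<one>\<^bsub>G\<^esub>}"

definition computable_config :: "'a set \<Rightarrow> (int \<Rightarrow> 'a) \<Rightarrow> bool" where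
  "computable_config A x \<longleftrightarrow>
     x \<in> full_shift A \<and> computable_fun (\<lambda>n. to_nat_on A (x (int_decode n)))"

end

theory Submission
  imports Defs
begin

text \<open>
  Effectiveness: in a recursively presented group the words representing the identity are
  semidecidable, since the normal closure of a recursively enumerable set of relators is
  enumerated by the finite products of conjugates of relators and their inverses. Forbidding a
  word from the moment when one of its suffixes is recognised as trivial, within a number of
  steps bounded by the length of the word, replaces this semidecidable set of forbidden words by
  a decidable one, because every trivial factor can be extended to the left as far as needed.

  Non-computability: the values in \<open>G\<close> of the words \<open>x\<^bsub>-n\<^esub> \<dots> x\<^bsub>-1\<^esub>\<close>
  are pairwise distinct, as two of them differ by the value of a nonempty factor of \<open>x\<close>. If
  \<open>x\<close> were computable, these words would yield an infinite recursively enumerable set of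
  elements of the free group on which the projection to \<open>G\<close> is injective.
\<close>

section \<open>Closure properties of computable functions\<close>

text \<open>\<open>mu_recursive\<close> depends on values at lists of the wrong length. Asking for
  agreement only on lists of length \<open>k\<close> allows rewriting by equations that hold at the
  right arity.\<close>

definition recursive_fun :: "nat \<Rightarrow> (nat list \<Rightarrow> nat) \<Rightarrow> bool" where
  "recursive_fun k f \<longleftrightarrow> (\<exists>F. mu_recursive k F \<and> (\<forall>xs. length xs = k \<longrightarrow> f xs = F xs))"

lemma recursive_fun_cong:
  assumes "recursive_fun k f" "\<And>xs. length xs = k \<Longrightarrow> g xs = f xs"
  shows "recursive_fun k g"
  using assms unfolding recursive_fun_def by metis

lemma recursive_fun_comp:
  assumes "recursive_fun (length gs) f" and "\<And>g. g \<in> set gs \<Longrightarrow> recursive_fun k g"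
  shows "recursive_fun k (\<lambda>xs. f (map (\<lambda>g. g xs) gs))"
proof -
  obtain F where F: "mu_recursive (length gs) F" "\<And>xs. length xs = length gs \<Longrightarrow> f xs = F xs"
    using assms(1) unfolding recursive_fun_def by blast
  obtain H where H: "\<And>g. g \<in> set gs \<Longrightarrow>
      mu_recursive k (H g) \<and> (\<forall>xs. length xs = k \<longrightarrow> g xs = H g xs)"
    using assms(2) unfolding recursive_fun_def by metis
  have "mu_recursive k (\<lambda>xs. F (map (\<lambda>g. g xs) (map H gs)))"
    by (rule mu_recursive.comp) (use F H in auto)
  moreover have "f (map (\<lambda>g. g xs) gs) = F (map (\<lambda>g. g xs) (map H gs))" if "length xs = k" for xs
  proof -
    have "map (\<lambda>g. g xs) gs = map (\<lambda>g. g xs) (map H gs)"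
      using H that by simp
    then show ?thesis
      using F(2)[of "map (\<lambda>g. g xs) gs"] by (simp only: length_map)
  qed
  ultimately show ?thesis
    unfolding recursive_fun_def by blast
qed

lemma recursive_fun_prim:
  assumes "recursive_fun k f" "recursive_fun (Suc (Suc k)) g"
  shows "recursive_fun (Suc k)
    (\<lambda>xs. rec_nat (f (tl xs)) (\<lambda>y r. g (y # r # tl xs)) (hd xs))"
proof -
  obtain F G where
    F: "mu_recursive k F" "\<And>xs. length xs = k \<Longrightarrow> f xs = F xs" and
    G: "mu_recursive (Suc (Suc k)) G" "\<And>xs. length xs = Suc (Suc k) \<Longrightarrow> g xs = G xs"
    using assms unfolding recursive_fun_def by blast
  have "rec_nat (f ys) (\<lambda>y r. g (y # r # ys)) n = rec_nat (F ys) (\<lambda>y r. G (y # r # ys)) n"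
    if "length ys = k" for n ys
    by (induction n) (simp_all add: F G that)
  then show ?thesis
    using mu_recursive.prim[OF F(1) G(1)] unfolding recursive_fun_def by fastforce
qed

lemma recursive_fun_nth: "i < k \<Longrightarrow> recursive_fun k (\<lambda>xs. xs ! i)"
  unfolding recursive_fun_def using mu_recursive.proj by blast

text \<open>In \<open>mu_recursive.prim\<close> the recursion variable is itself an argument; here
  the bound \<open>b\<close> is any recursive function of the arguments. Compose
  \<open>recursive_fun_prim\<close> with \<open>b\<close> followed by all projections.\<close>

lemma recursive_fun_rec_nat:
  assumes "recursive_fun k f" "recursive_fun (Suc (Suc k)) g" "recursive_fun k b"
  shows "recursive_fun k (\<lambda>xs. rec_nat (f xs) (\<lambda>y r. g (y # r # xs)) (b xs))"
proof -
  let ?gs = "b # map (\<lambda>i xs. xs ! i) [0..<k]"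
  have *: "map (\<lambda>g. g xs) ?gs = b xs # xs" if "length xs = k" for xs :: "nat list"
    using that by (auto simp: o_def map_nth)
  have "recursive_fun k (\<lambda>xs. (\<lambda>xs. rec_nat (f (tl xs)) (\<lambda>y r. g (y # r # tl xs)) (hd xs))
      (map (\<lambda>g. g xs) ?gs))"
    by (rule recursive_fun_comp)
      (use recursive_fun_prim[OF assms(1,2)] assms(3) recursive_fun_nth in auto)
  then show ?thesis
    by (rule recursive_fun_cong) (simp only: *, simp)
qed

lemma recursive_fun_Suc:
  assumes "recursive_fun k a"
  shows "recursive_fun k (\<lambda>xs. Suc (a xs))"
proof -
  have "recursive_fun 1 (\<lambda>xs. Suc (xs ! 0))"
    unfolding recursive_fun_def using mu_recursive.succ by blast
  then show ?thesis
    using recursive_fun_comp[of "[a]" "\<lambda>xs. Suc (xs ! 0)" k] assms by simp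
qed

lemma recursive_fun_const: "recursive_fun k (\<lambda>xs. c)"
proof (induction c)
  case 0
  then show ?case unfolding recursive_fun_def using mu_recursive.zero by blast
qed (rule recursive_fun_Suc)

lemma recursive_fun_add:
  assumes "recursive_fun k a" "recursive_fun k b"
  shows "recursive_fun k (\<lambda>xs. a xs + b xs)"
proof -
  have "recursive_fun (Suc (Suc k)) (\<lambda>zs. Suc (zs ! 1))"
    by (intro recursive_fun_Suc recursive_fun_nth) simp
  from recursive_fun_rec_nat[OF assms(2) this assms(1)] show ?thesis
  proof (rule recursive_fun_cong)
    have "m + n = rec_nat n (\<lambda>y r. Suc ((y # r # xs) ! 1)) m" for m n and xs :: "nat list"
      by (induction m) auto
    then show "a xs + b xs = rec_nat (b xs) (\<lambda>y r. Suc ((y # r # xs) ! 1)) (a xs)" for xs .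
  qed
qed

lemma recursive_fun_diff:
  assumes "recursive_fun k a" "recursive_fun k b"
  shows "recursive_fun k (\<lambda>xs. a xs - b xs)"
proof -
  \<comment> \<open>Truncated subtraction iterates the predecessor, and the predecessor is a
    recursion whose step returns its counter.\<close>
  have pred: "recursive_fun k (\<lambda>xs. c xs - 1)" if "recursive_fun k c" for k c
  proof -
    have "recursive_fun (Suc (Suc k)) (\<lambda>zs. zs ! 0)"
      by (intro recursive_fun_nth) simp
    from recursive_fun_rec_nat[OF recursive_fun_const this that] show ?thesis
    proof (rule recursive_fun_cong)
      show "c xs - 1 = rec_nat 0 (\<lambda>y r. (y # r # xs) ! 0) (c xs)" for xs
        by (cases "c xs") auto
    qed
  qed
  have "recursive_fun (Suc (Suc k)) (\<lambda>zs. zs ! 1 - 1)"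
    by (intro pred recursive_fun_nth) simp
  from recursive_fun_rec_nat[OF assms(1) this assms(2)] show ?thesis
  proof (rule recursive_fun_cong)
    have "m - n = rec_nat m (\<lambda>y r. (y # r # xs) ! 1 - 1) n" for m n and xs :: "nat list"
      by (induction n) auto
    then show "a xs - b xs = rec_nat (a xs) (\<lambda>y r. (y # r # xs) ! 1 - 1) (b xs)" for xs .
  qed
qed

section \<open>Cantor pairing and its inverse\<close>

lemma recursive_fun_triangle:
  assumes "recursive_fun k a"
  shows "recursive_fun k (\<lambda>xs. triangle (a xs))"
proof -
  have "recursive_fun (Suc (Suc k)) (\<lambda>zs. zs ! 1 + Suc (zs ! 0))"
    by (intro recursive_fun_add recursive_fun_Suc recursive_fun_nth) auto
  from recursive_fun_rec_nat[OF recursive_fun_const this assms] show ?thesis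
  proof (rule recursive_fun_cong)
    have "triangle n = rec_nat 0 (\<lambda>y r. (y # r # xs) ! 1 + Suc ((y # r # xs) ! 0)) n"
      for n and xs :: "nat list"
      by (induction n) auto
    then show "triangle (a xs) =
      rec_nat 0 (\<lambda>y r. (y # r # xs) ! 1 + Suc ((y # r # xs) ! 0)) (a xs)" for xs .
  qed
qed

lemma recursive_fun_prod_encode:
  assumes "recursive_fun k a" "recursive_fun k b"
  shows "recursive_fun k (\<lambda>xs. prod_encode (a xs, b xs))"
  unfolding prod_encode_def prod.case
  by (intro recursive_fun_add recursive_fun_triangle assms)

text \<open>The largest \<open>r\<close> with \<open>triangle r \<le> n\<close> in primitive
  recursive form: the increment is \<open>1\<close> exactly when
  \<open>triangle (Suc r) \<le> Suc y\<close>, because subtraction truncates at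
  \<open>0\<close>.\<close>

definition triangle_root :: "nat \<Rightarrow> nat" where
  "triangle_root n = rec_nat 0 (\<lambda>y r. r + (1 - (triangle (Suc r) - Suc y))) n"

lemma triangle_root_bounds:
  "triangle (triangle_root n) \<le> n \<and> n < triangle (Suc (triangle_root n))"
proof (induction n)
  case (Suc n)
  have "triangle_root (Suc n) =
      triangle_root n + (1 - (triangle (Suc (triangle_root n)) - Suc n))"
    by (simp add: triangle_root_def)
  then show ?case
    using Suc by (cases "triangle (Suc (triangle_root n)) \<le> Suc n") auto
qed (simp add: triangle_root_def)

lemma triangle_mono: "m \<le> n \<Longrightarrow> triangle m \<le> triangle n"
  by (rule lift_Suc_mono_le[of triangle]) auto

text \<open>If \<open>n\<close> codes \<open>(a, b)\<close>, then
  \<open>n = triangle (a + b) + a\<close> lies below \<open>triangle (Suc (a + b))\<close>, so the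
  bounds force the root to be \<open>a + b\<close>. Both components can then be recovered by
  subtraction.\<close>

lemma triangle_root_eq: "triangle_root n = fst (prod_decode n) + snd (prod_decode n)"
proof -
  obtain a b where ab: "prod_decode n = (a, b)"
    by fastforce
  then have n: "n = triangle (a + b) + a"
    using prod_decode_inverse[of n] by (simp add: prod_encode_def)
  have "\<not> triangle_root n < a + b"
    using triangle_root_bounds[of n] triangle_mono[of "Suc (triangle_root n)" "a + b"] n by linarith
  moreover have "\<not> a + b < triangle_root n"
    using triangle_root_bounds[of n] triangle_mono[of "Suc (a + b)" "triangle_root n"] n
    by (fastforce simp: Suc_le_eq)
  ultimately show ?thesis
    using ab by simp
qed

lemma recursive_fun_triangle_root:
  assumes "recursive_fun k a"
  shows "recursive_fun k (\<lambda>xs. triangle_root (a xs))"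
proof -
  have "recursive_fun (Suc (Suc k)) (\<lambda>zs. zs ! 1 + (1 - (triangle (Suc (zs ! 1)) - Suc (zs ! 0))))"
    by (intro recursive_fun_add recursive_fun_diff recursive_fun_triangle recursive_fun_Suc
        recursive_fun_nth recursive_fun_const) auto
  from recursive_fun_rec_nat[OF recursive_fun_const this assms] show ?thesis
    by (rule recursive_fun_cong) (simp add: triangle_root_def)
qed

lemma recursive_fun_fst_prod_decode:
  assumes "recursive_fun k a"
  shows "recursive_fun k (\<lambda>xs. fst (prod_decode (a xs)))"
proof -
  have "fst (prod_decode n) = n - triangle (triangle_root n)" for n
  proof -
    obtain a b where ab: "prod_decode n = (a, b)"
      by fastforce
    then have "n = triangle (a + b) + a"
      using prod_decode_inverse[of n] by (simp add: prod_encode_def)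
    then show ?thesis
      using ab by (simp add: triangle_root_eq)
  qed
  then show ?thesis
    using assms
    by (simp add: recursive_fun_diff recursive_fun_triangle recursive_fun_triangle_root)
qed

lemma recursive_fun_snd_prod_decode:
  assumes "recursive_fun k a"
  shows "recursive_fun k (\<lambda>xs. snd (prod_decode (a xs)))"
proof -
  have "snd (prod_decode n) = triangle_root n - fst (prod_decode n)" for n
    by (simp add: triangle_root_eq)
  then show ?thesis
    using assms
    by (simp add: recursive_fun_diff recursive_fun_fst_prod_decode recursive_fun_triangle_root)
qed

section \<open>Unary computable functions\<close>

lemma computable_fun_iff: "computable_fun f \<longleftrightarrow> recursive_fun 1 (\<lambda>xs. f (xs ! 0))"
proof
  assume "recursive_fun 1 (\<lambda>xs. f (xs ! 0))"
  then obtain F where "mu_recursive 1 F" "\<And>xs. length xs = 1 \<Longrightarrow> f (xs ! 0) = F xs"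
    unfolding recursive_fun_def by blast
  from this(1) this(2)[of "[_]"] show "computable_fun f"
    unfolding computable_fun_def by auto
qed (auto simp: computable_fun_def recursive_fun_def length_Suc_conv)

lemma recursive_fun_computable_fun:
  assumes "computable_fun f" "recursive_fun k a"
  shows "recursive_fun k (\<lambda>xs. f (a xs))"
  using recursive_fun_comp[of "[a]" "\<lambda>xs. f (xs ! 0)" k] assms by (simp add: computable_fun_iff)

abbreviation pfst :: "nat \<Rightarrow> nat" where "pfst e \<equiv> fst (prod_decode e)"
abbreviation psnd :: "nat \<Rightarrow> nat" where "psnd e \<equiv> snd (prod_decode e)"

text \<open>
  Several arguments are passed to a unary computable function as a single coded pair; a
  higher-order hypothesis on a function \<open>h\<close> of three arguments then reads
  \<open>computable_fun (\<lambda>e. h (pfst e) (pfst (psnd e)) (psnd (psnd e)))\<close>.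
\<close>

named_theorems computable_intros

lemma computable_fun_id [computable_intros]: "computable_fun (\<lambda>n. n)"
  and computable_fun_const [computable_intros]: "computable_fun (\<lambda>n. c)"
  by (simp_all add: computable_fun_iff recursive_fun_nth recursive_fun_const)

lemma computable_fun_comp:
  "computable_fun f \<Longrightarrow> computable_fun a \<Longrightarrow> computable_fun (\<lambda>n. f (a n))"
  using recursive_fun_computable_fun computable_fun_iff by simp

lemma computable_fun_basic [computable_intros]:
  assumes "computable_fun a"
  shows "computable_fun (\<lambda>n. Suc (a n))"
    and "computable_fun (\<lambda>n. pfst (a n))"
    and "computable_fun (\<lambda>n. psnd (a n))"
  using assms
  by (simp_all add: computable_fun_iff recursive_fun_Suc recursive_fun_fst_prod_decode
      recursive_fun_snd_prod_decode)

lemma computable_fun_basic2 [computable_intros]: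
  assumes "computable_fun a" "computable_fun b"
  shows "computable_fun (\<lambda>n. a n + b n)"
    and "computable_fun (\<lambda>n. a n - b n)"
    and "computable_fun (\<lambda>n. prod_encode (a n, b n))"
  using assms
  by (simp_all add: computable_fun_iff recursive_fun_add recursive_fun_diff
      recursive_fun_prod_encode)

lemma computable_fun_rec_nat [computable_intros]:
  assumes "computable_fun f"
    and "computable_fun (\<lambda>e. h (pfst e) (pfst (psnd e)) (psnd (psnd e)))"
    and "computable_fun b"
  shows "computable_fun (\<lambda>n. rec_nat (f n) (h n) (b n))"
proof -
  let ?h = "\<lambda>e. h (pfst e) (pfst (psnd e)) (psnd (psnd e))"
  \<comment> \<open>The recursion supplies counter, previous value and then the parameter, whereas
    \<open>h\<close> takes the parameter first; the triple is repacked accordingly.\<close>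
  have "recursive_fun 3 (\<lambda>zs. ?h (prod_encode (zs ! 2, prod_encode (zs ! 0, zs ! 1))))"
    by (intro recursive_fun_computable_fun[OF assms(2)] recursive_fun_prod_encode recursive_fun_nth)
      auto
  then have "recursive_fun (Suc (Suc 1)) (\<lambda>zs. h (zs ! 2) (zs ! 0) (zs ! 1))"
    by (simp add: numeral_3_eq_3)
  from recursive_fun_rec_nat[OF _ this] show ?thesis
    using assms(1,3) by (simp add: computable_fun_iff)
qed

lemma computable_fun_if_eq [computable_intros]:
  assumes "computable_fun a" "computable_fun b" "computable_fun c" "computable_fun d"
  shows "computable_fun (\<lambda>n. if a n = b n then c n else d n)"
proof -
  \<comment> \<open>Equality means that both truncated differences vanish; the recursion branches on
    their sum and its step ignores counter and previous value.\<close>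
  have "(if a n = b n then c n else d n) = rec_nat (c n) (\<lambda>_ _. d n) ((a n - b n) + (b n - a n))"
    for n by (cases "(a n - b n) + (b n - a n)") auto
  then show ?thesis
    by (simp only:) (intro computable_intros assms computable_fun_comp[OF assms(4)])
qed

lemma computable_fun_if_less [computable_intros]:
  assumes "computable_fun a" "computable_fun b" "computable_fun c" "computable_fun d"
  shows "computable_fun (\<lambda>n. if a n < b n then c n else d n)"
proof -
  have "(if a n < b n then c n else d n) = (if Suc (a n) - b n = 0 then c n else d n)" for n
    by auto
  then show ?thesis
    by (simp only:) (intro computable_intros assms)
qed

text \<open>Induction on \<open>m\<close>, patching one value at a time. This serves for tables on a
  finite alphabet that are extended by a default value.\<close>

lemma computable_fun_finite:
  assumes "\<And>k. k \<ge> m \<Longrightarrow> f k = c"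
  shows "computable_fun f"
  using assms
proof (induction m arbitrary: f)
  case 0
  then have "f = (\<lambda>n. c)" by auto
  then show ?case by (simp add: computable_fun_const)
next
  case (Suc m)
  have "computable_fun (\<lambda>k. if k = m then c else f k)"
    by (rule Suc.IH) (use Suc.prems in \<open>auto simp: le_neq_implies_less Suc_leI\<close>)
  from computable_fun_if_eq[OF computable_fun_id computable_fun_const computable_fun_const this]
  have "computable_fun (\<lambda>k. if k = m then f m else if k = m then c else f k)" .
  moreover have "(\<lambda>k. if k = m then f m else if k = m then c else f k) = f"
    by auto
  ultimately show ?case
    by (rule back_subst[of computable_fun])
qed

lemma length_le_list_encode: "length xs \<le> list_encode xs"
proof (induction xs)
  case (Cons x xs)
  then show ?case using le_prod_encode_2[of "list_encode xs" x] by simp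
qed simp

text \<open>A state pairs the code of the remaining list with the accumulator, and \<open>st\<close>
  consumes one entry. Iterating \<open>l n\<close> times suffices, since a list is no longer than
  its code and surplus steps fix a state whose list is empty.\<close>

lemma computable_fun_fold [computable_intros]:
  assumes "computable_fun (\<lambda>e. h (pfst e) (pfst (psnd e)) (psnd (psnd e)))"
    and "computable_fun l" and "computable_fun i"
  shows "computable_fun (\<lambda>n. fold (h n) (list_decode (l n)) (i n))"
proof -
  define st where "st n s = (if pfst s = 0 then s
    else prod_encode (psnd (pfst s - 1), h n (pfst (pfst s - 1)) (psnd s)))" for n s
  have st_Nil: "st n (prod_encode (0, a)) = prod_encode (0, a)"
    and st_Cons: "st n (prod_encode (Suc m, a)) = prod_encode (psnd m, h n (pfst m) a)" for n m a
    by (simp_all add: st_def)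
  have st: "(st n ^^ k) (prod_encode (list_encode xs, a)) = prod_encode (0, fold (h n) xs a)"
    if "length xs \<le> k" for n k xs a
    using that
  proof (induction k arbitrary: xs a)
    case (Suc k)
    then show ?case
      using Suc.IH[of "[]" a] by (cases xs) (auto simp: funpow_Suc_right st_Nil st_Cons simp del: funpow.simps)
  qed simp
  have "(st n ^^ k) s = rec_nat s (\<lambda>_. st n) k" for n k s
    by (induction k) auto
  then have "fold (h n) (list_decode (l n)) (i n) =
      psnd (rec_nat (prod_encode (l n, i n)) (\<lambda>_. st n) (l n))" for n
    using st[of "list_decode (l n)" "l n" n "i n"] length_le_list_encode[of "list_decode (l n)"]
    by simp
  \<comment> \<open>Inside the recursion the head and the accumulator are parts of the state
    \<open>psnd (psnd e)\<close>, so the hypothesis on \<open>h\<close> is transported to these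
    arguments.\<close>
  moreover have "computable_fun (\<lambda>e. h (pfst e) (pfst (pfst (psnd (psnd e)) - 1)) (psnd (psnd (psnd e))))"
    using computable_fun_comp[OF assms(1), of "\<lambda>e. prod_encode (pfst e, 
       prod_encode (pfst (pfst (psnd (psnd e)) - 1), psnd (psnd (psnd e))))"]
    by (simp add: computable_intros)
  ultimately show ?thesis
    unfolding st_def by (simp only:) (intro computable_intros assms(2,3))
qed

lemma computable_fun_if_mem:
  assumes "decidable_set V" "computable_fun a" "computable_fun b" "computable_fun c"
  shows "computable_fun (\<lambda>n. if a n \<in> V then b n else c n)"
proof -
  have "(if a n \<in> V then b n else c n) = (if (if a n \<in> V then 1 else 0) = (1::nat) then b n else c n)"
    for n by simp
  moreover have "computable_fun (\<lambda>n. if a n \<in> V then 1 else 0)"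
    using computable_fun_comp[OF assms(1)[unfolded decidable_set_def] assms(2)] .
  ultimately show ?thesis
    by (simp only:) (intro computable_intros assms(3,4))
qed

text \<open>A \<open>foldr\<close> is a \<open>fold\<close> over the reversed list, and reversal is
  itself a \<open>fold\<close> that conses onto a code.\<close>

lemma computable_fun_foldr [computable_intros]:
  assumes "computable_fun (\<lambda>e. h (pfst e) (pfst (psnd e)) (psnd (psnd e)))"
    and "computable_fun l" and "computable_fun i"
  shows "computable_fun (\<lambda>n. foldr (h n) (list_decode (l n)) (i n))"
proof -
  have "list_encode (rev xs @ list_decode c) = fold (\<lambda>k c. Suc (prod_encode (k, c))) xs c" for xs c
  proof (induction xs arbitrary: c)
    case (Cons x xs)
    show ?case
      using Cons.IH[of "Suc (prod_encode (x, c))"] by simp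
  qed simp
  from this[of _ 0] have "list_decode (fold (\<lambda>k c. Suc (prod_encode (k, c))) xs 0) = rev xs" for xs
    using list_encode_inverse[of "rev xs"] by simp
  then have "foldr (h n) (list_decode (l n)) (i n) = fold (h n) (list_decode
      (fold (\<lambda>k c. Suc (prod_encode (k, c))) (list_decode (l n)) 0)) (i n)" for n
    by (simp add: foldr_conv_fold)
  then show ?thesis
    by (simp only:) (intro computable_intros assms)
qed

section \<open>Codes of words over a finite alphabet\<close>

lemma word_code_Nil [simp]: "word_code A [] = 0"
  and word_code_Cons [simp]:
    "word_code A (x # w) = Suc (prod_encode (to_nat_on A x, word_code A w))"
  by (simp_all add: word_code_def)

lemma to_nat_on_less_card:
  assumes "finite A" "x \<in> A"
  shows "to_nat_on A x < card A"
  using to_nat_on_finite[OF assms(1)] assms(2) by (auto simp: bij_betw_def)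

text \<open>Every number codes some list, so only the range of its entries has to be tested. This is
  what makes the set of codes decidable.\<close>

lemma word_code_image_lists:
  assumes "finite A"
  shows "word_code A ` lists A = {n. \<forall>k\<in>set (list_decode n). k < card A}"
proof -
  have "to_nat_on A ` A = {..<card A}"
    using to_nat_on_finite[OF assms] by (rule bij_betw_imp_surj_on)
  then have "map (to_nat_on A) ` lists A = lists {..<card A}"
    by (simp flip: lists_image)
  moreover have "word_code A ` lists A = list_encode ` map (to_nat_on A) ` lists A"
    by (simp add: word_code_def image_image)
  ultimately have "word_code A ` lists A = list_encode ` lists {..<card A}"
    by simp
  also have "\<dots> = {n. \<forall>k\<in>set (list_decode n). k < card A}"
  proof (intro equalityI subsetI)
    fix n assume "n \<in> {n. \<forall>k\<in>set (list_decode n). k < card A}"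
    then have "list_encode (list_decode n) \<in> list_encode ` lists {..<card A}"
      by (intro imageI) (auto simp: lists_eq_set)
    then show "n \<in> list_encode ` lists {..<card A}"
      by simp
  qed auto
  finally show ?thesis .
qed

lemma decidable_word_code_image_lists:
  assumes "finite A"
  shows "decidable_set (word_code A ` lists A)"
proof -
  have "fold (\<lambda>k b. if k < m then b else 0) ks b = (if \<forall>k\<in>set ks. k < m then b else 0)"
    for m b :: nat and ks
    by (induction ks arbitrary: b) auto
  then have "(if n \<in> word_code A ` lists A then 1 else 0) =
      fold (\<lambda>k b. if k < card A then b else 0) (list_decode n) (1::nat)" for n
    by (simp add: word_code_image_lists[OF assms])
  then show ?thesis
    unfolding decidable_set_def by (simp only:) (intro computable_intros)
qed

section \<open>The free group on codes of words\<close>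

text \<open>The default \<open>0\<close> beyond the codes of letters makes the function eventually
  constant, hence computable.\<close>

definition flip_code :: "'a set \<Rightarrow> nat \<Rightarrow> nat" where
  "flip_code S k = (if k < card (letters S)
     then to_nat_on (letters S) (flip (from_nat_into (letters S) k)) else 0)"

text \<open>A nonempty list has a code of the form \<open>Suc (prod_encode (head, tail))\<close>:
  here \<open>c = 0\<close> is the empty word, and otherwise \<open>c - 1\<close> unpacks to head
  and tail.\<close>

definition cancel_code :: "'a set \<Rightarrow> nat \<Rightarrow> nat \<Rightarrow> nat" where
  "cancel_code S k c = (if c = 0 then Suc (prod_encode (k, c))
     else if pfst (c - 1) = flip_code S k then psnd (c - 1) else Suc (prod_encode (k, c)))"

definition mult_code :: "'a set \<Rightarrow> nat \<Rightarrow> nat \<Rightarrow> nat" where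
  "mult_code S a b = foldr (cancel_code S) (list_decode a) b"

text \<open>Left multiplication of \<open>b\<close> by the inverse of the word coded by
  \<open>a\<close>. Inversion reverses the word, so the flip of its first letter acts first and
  \<open>foldr\<close> becomes \<open>fold\<close>.\<close>

definition left_div_code :: "'a set \<Rightarrow> nat \<Rightarrow> nat \<Rightarrow> nat" where
  "left_div_code S a b = fold (\<lambda>k. cancel_code S (flip_code S k)) (list_decode a) b"

lemma computable_fun_flip_code [computable_intros]:
  "computable_fun a \<Longrightarrow> computable_fun (\<lambda>n. flip_code S (a n))"
  by (rule computable_fun_comp[OF computable_fun_finite[of "card (letters S)" _ 0]])
    (simp add: flip_code_def)

lemma computable_fun_cancel_code [computable_intros]:
  assumes "computable_fun a" "computable_fun b"
  shows "computable_fun (\<lambda>n. cancel_code S (a n) (b n))"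
  unfolding cancel_code_def by (intro computable_intros assms)

lemma computable_fun_mult_code [computable_intros]:
  assumes "computable_fun a" "computable_fun b"
  shows "computable_fun (\<lambda>n. mult_code S (a n) (b n))"
  unfolding mult_code_def by (intro computable_intros assms)

lemma computable_fun_left_div_code [computable_intros]:
  assumes "computable_fun a" "computable_fun b"
  shows "computable_fun (\<lambda>n. left_div_code S (a n) (b n))"
  unfolding left_div_code_def by (intro computable_intros assms)

lemma flip_in_letters [simp]: "flip x \<in> letters S \<longleftrightarrow> x \<in> letters S"
  by (cases x) (simp add: flip_def)

lemma flip_code_to_nat_on:
  assumes "finite S" "x \<in> letters S"
  shows "flip_code S (to_nat_on (letters S) x) = to_nat_on (letters S) (flip x)"
  using assms to_nat_on_less_card[of "letters S" x]
  by (simp add: flip_code_def countable_finite)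

lemma cancel_cons_in_lists:
  "x \<in> letters S \<Longrightarrow> w \<in> lists (letters S) \<Longrightarrow> cancel_cons x w \<in> lists (letters S)"
  using set_cancel_cons[of x w] by (auto simp: lists_eq_set)

lemma foldr_cancel_cons_in_lists:
  "u \<in> lists (letters S) \<Longrightarrow> w \<in> lists (letters S) \<Longrightarrow>
    foldr cancel_cons u w \<in> lists (letters S)"
  using set_foldr_cancel_cons[of u w] by (auto simp: lists_eq_set)

lemma word_code_cancel_cons:
  assumes "finite S" "x \<in> letters S" "w \<in> lists (letters S)"
  shows "word_code (letters S) (cancel_cons x w) =
    cancel_code S (to_nat_on (letters S) x) (word_code (letters S) w)"
proof (cases w)
  case (Cons y u)
  have "countable (letters S)"
    using assms(1) by (simp add: countable_finite)
  moreover have "y \<in> letters S" "flip x \<in> letters S"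
    using assms Cons by auto
  ultimately have "to_nat_on (letters S) y = to_nat_on (letters S) (flip x) \<longleftrightarrow> y = flip x"
    by (rule to_nat_on_inj)
  then show ?thesis
    using flip_code_to_nat_on[OF assms(1,2)] by (simp add: Cons cancel_code_def)
qed (simp add: cancel_code_def)

lemma word_code_foldr_cancel_cons:
  assumes "finite S" "u \<in> lists (letters S)" "w \<in> lists (letters S)"
  shows "word_code (letters S) (foldr cancel_cons u w) =
    mult_code S (word_code (letters S) u) (word_code (letters S) w)"
  using assms(2)
proof (induction u)
  case (Cons x u)
  then show ?case
    using assms word_code_cancel_cons[of S x "foldr cancel_cons u w"] foldr_cancel_cons_in_lists[of u S w]
    by (simp add: mult_code_def)
qed (simp add: mult_code_def)

lemma word_code_foldr_cancel_cons_rev_flip: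
  assumes "finite S" "u \<in> lists (letters S)" "w \<in> lists (letters S)"
  shows "word_code (letters S) (foldr cancel_cons (rev (map flip u)) w) =
    left_div_code S (word_code (letters S) u) (word_code (letters S) w)"
  using assms(2,3)
proof (induction u arbitrary: w)
  case (Cons x u)
  then show ?case
    using assms(1) cancel_cons_in_lists[of "flip x" S w] flip_in_letters[of x S]
    by (simp add: left_div_code_def word_code_cancel_cons flip_code_to_nat_on del: flip_in_letters)
qed (simp add: left_div_code_def)

section \<open>Enumerating a normal closure\<close>

lemma one_free_group [simp]: "\<one>\<^bsub>free_group S\<^esub> = []"
  by (simp add: free_group_def)

lemma carrier_free_groupD: "w \<in> carrier (free_group S) \<Longrightarrow> reduced w \<and> w \<in> lists (letters S)"
  by (simp add: free_group_def)

lemma reduced_Nil [simp]: "reduced []"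
  by (simp add: reduced_def)

lemma foldr_cancel_cons_in_carrier:
  assumes "w \<in> lists (letters S)" "u \<in> carrier (free_group S)"
  shows "foldr cancel_cons w u \<in> carrier (free_group S)"
  using assms foldr_cancel_cons_in_lists[of w S u]
  by (simp add: free_group_def reduced_foldr_cancel_cons)

lemma Nil_in_free_group [simp]: "[] \<in> carrier (free_group S)"
  by (simp add: free_group_def)

text \<open>A word \<open>w\<close>, reduced or not, acts as left multiplication by its reduced form
  \<open>foldr cancel_cons w []\<close>. Hence conjugating words may be drawn from all words over
  the letters.\<close>

lemma foldr_cancel_cons_eq_mult:
  assumes "u \<in> carrier (free_group S)"
  shows "foldr cancel_cons w u = foldr cancel_cons w [] \<otimes>\<^bsub>free_group S\<^esub> u"
  using carrier_free_groupD[OF assms] foldr_cancel_cons_assoc[of u w "[]"]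
  by (simp add: free_group_def)

lemma rev_map_flip_in_lists:
  "w \<in> lists (letters S) \<Longrightarrow> rev (map flip w) \<in> lists (letters S)"
  by (induction w) (auto simp: flip_def)

lemma foldr_cancel_cons_rev_flip_eq_inv:
  assumes "w \<in> lists (letters S)"
  shows "foldr cancel_cons (rev (map flip w)) [] = inv\<^bsub>free_group S\<^esub> (foldr cancel_cons w [])"
proof -
  interpret group "free_group S" by (rule group_free_group)
  let ?w = "foldr cancel_cons w []" and ?v = "foldr cancel_cons (rev (map flip w)) []"
  have "?w \<in> carrier (free_group S)" "?v \<in> carrier (free_group S)"
    by (intro foldr_cancel_cons_in_carrier rev_map_flip_in_lists assms Nil_in_free_group)+
  moreover have "?v \<otimes>\<^bsub>free_group S\<^esub> ?w = \<one>\<^bsub>free_group S\<^esub>"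
    using foldr_cancel_cons_eq_mult[OF calculation(1), of "rev (map flip w)"]
      foldr_cancel_cons_inverse[of "[]" w] by simp
  ultimately show ?thesis
    by (rule inv_equality[symmetric, rotated])
qed

text \<open>The rule \<open>generate.induct\<close> multiplies two arbitrary members. Proving
  \<open>P (x \<otimes> u)\<close> for every \<open>u\<close> with \<open>P u\<close> instead
  reduces a product to two successive left multiplications.\<close>

lemma (in group) generate_left_induct [consumes 2, case_names one mult inv]:
  assumes "x \<in> generate G H" "H \<subseteq> carrier G"
    and "P \<one>"
    and "\<And>h u. h \<in> H \<Longrightarrow> u \<in> generate G H \<Longrightarrow> P u \<Longrightarrow> P (h \<otimes> u)"
    and "\<And>h u. h \<in> H \<Longrightarrow> u \<in> generate G H \<Longrightarrow> P u \<Longrightarrow> P (inv h \<otimes> u)"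
  shows "P x"
proof -
  have "P (x \<otimes> u)" if "u \<in> generate G H" "P u" for u
    using assms(1) that
  proof (induction arbitrary: u rule: generate.induct)
    case one
    then show ?case using generate_in_carrier[OF assms(2)] by simp
  next
    case (eng a b)
    have "a \<otimes> (b \<otimes> u) = a \<otimes> b \<otimes> u"
      using eng generate_in_carrier[OF assms(2)] by (simp add: m_assoc)
    then show ?case
      using eng generate.eng[of b G H u] by metis
  qed (use assms in auto)
  from this[OF generate.one assms(3)] show ?thesis
    using generate_in_carrier[OF assms(2,1)] by simp
qed

text \<open>Conjugating by \<open>g\<close> turns the conjugate of \<open>r\<close> under
  \<open>k\<close> into the one under \<open>g \<otimes> k\<close>, so the generating set is closed
  under conjugation.\<close>

lemma (in group) normal_normal_closure:
  assumes "R \<subseteq> carrier G"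
  shows "normal_closure G R \<lhd> G"
  unfolding normal_closure_def
proof (rule normal_generateI)
  fix h g assume h: "h \<in> {g \<otimes> r \<otimes> inv g |g r. g \<in> carrier G \<and> r \<in> R}" and g: "g \<in> carrier G"
  then obtain k r where k: "k \<in> carrier G" "r \<in> R" "h = k \<otimes> r \<otimes> inv k"
    by blast
  moreover from this have "g \<otimes> h \<otimes> inv g = (g \<otimes> k) \<otimes> r \<otimes> inv (g \<otimes> k)"
    using g assms by (auto simp: m_assoc inv_mult_group subset_iff)
  ultimately show "g \<otimes> h \<otimes> inv g \<in> {g \<otimes> r \<otimes> inv g |g r. g \<in> carrier G \<and> r \<in> R}"
    using g by blast
qed (use assms in auto)

text \<open>The bracketing matches the computation on codes: a left division by \<open>g\<close>,
  then a multiplication or division by the relator, then a multiplication by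
  \<open>g\<close>.\<close>

lemma (in group) normal_closure_left_induct [consumes 2, case_names one mult inv]:
  assumes "x \<in> normal_closure G R" "R \<subseteq> carrier G"
    and "P \<one>"
    and "\<And>g r u. g \<in> carrier G \<Longrightarrow> r \<in> R \<Longrightarrow> u \<in> normal_closure G R \<Longrightarrow> P u \<Longrightarrow>
      P (g \<otimes> (r \<otimes> (inv g \<otimes> u)))"
    and "\<And>g r u. g \<in> carrier G \<Longrightarrow> r \<in> R \<Longrightarrow> u \<in> normal_closure G R \<Longrightarrow> P u \<Longrightarrow>
      P (g \<otimes> (inv r \<otimes> (inv g \<otimes> u)))"
  shows "P x"
proof -
  interpret N: normal "normal_closure G R" G
    using assms(2) by (rule normal_normal_closure)
  have C: "{g \<otimes> r \<otimes> inv g |g r. g \<in> carrier G \<and> r \<in> R} \<subseteq> carrier G"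
    using assms(2) by auto
  show ?thesis
    using assms(1) C unfolding normal_closure_def
  proof (induction rule: generate_left_induct)
    case (mult h u)
    then obtain g r where gr: "g \<in> carrier G" "r \<in> R" "h = g \<otimes> r \<otimes> inv g"
      by blast
    have u: "u \<in> normal_closure G R"
      using mult by (simp add: normal_closure_def)
    then have "h \<otimes> u = g \<otimes> (r \<otimes> (inv g \<otimes> u))"
      using gr assms(2) N.subset by (auto simp: m_assoc subset_iff)
    then show ?case
      using assms(4)[OF gr(1,2) u] mult by simp
  next
    case (inv h u)
    then obtain g r where gr: "g \<in> carrier G" "r \<in> R" "h = g \<otimes> r \<otimes> inv g"
      by blast
    have u: "u \<in> normal_closure G R"
      using inv by (simp add: normal_closure_def)
    then have "inv h \<otimes> u = g \<otimes> (inv r \<otimes> (inv g \<otimes> u))"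
      using gr assms(2) N.subset by (auto simp: m_assoc inv_mult_group subset_iff)
    then show ?case
      using assms(5)[OF gr(1,2) u] inv by simp
  qed (use assms(3) in simp)
qed

lemma (in group) normal_closure_conj_mult:
  assumes "R \<subseteq> carrier G" "g \<in> carrier G" "r \<in> insert \<one> R" "u \<in> normal_closure G R"
  shows "g \<otimes> (r \<otimes> (inv g \<otimes> u)) \<in> normal_closure G R"
    and "g \<otimes> (inv r \<otimes> (inv g \<otimes> u)) \<in> normal_closure G R"
proof -
  interpret N: normal "normal_closure G R" G
    using assms(1) by (rule normal_normal_closure)
  have carr: "r \<in> carrier G" "u \<in> carrier G"
    using assms N.subset by auto
  have c: "g \<otimes> r \<otimes> inv g \<in> normal_closure G R"
  proof (cases "r \<in> R")
    case True
    then show ?thesis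
      unfolding normal_closure_def using assms(2) by (intro generate.incl) blast
  qed (use assms in auto)
  have "(g \<otimes> r \<otimes> inv g) \<otimes> u = g \<otimes> (r \<otimes> (inv g \<otimes> u))"
    and "inv (g \<otimes> r \<otimes> inv g) \<otimes> u = g \<otimes> (inv r \<otimes> (inv g \<otimes> u))"
    using assms(2) carr by (auto simp: m_assoc inv_mult_group)
  then show "g \<otimes> (r \<otimes> (inv g \<otimes> u)) \<in> normal_closure G R"
    and "g \<otimes> (inv r \<otimes> (inv g \<otimes> u)) \<in> normal_closure G R"
    using N.m_closed[OF c assms(4)] N.m_closed[OF N.m_inv_closed[OF c] assms(4)] by simp_all
qed

text \<open>
  The argument \<open>p\<close> codes a triple \<open>(g, b, i)\<close>, and the operation multiplies by the
  conjugate under \<open>g\<close> of the relator with code \<open>f i\<close> or, if \<open>b \<noteq> 0\<close>,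
  of its inverse. Arguments where \<open>g\<close> is no code of a word act as the identity.
\<close>

definition conj_mult_code :: "'a set \<Rightarrow> (nat \<Rightarrow> nat) \<Rightarrow> nat \<Rightarrow> nat \<Rightarrow> nat" where
  "conj_mult_code S f p c =
     (if pfst p \<in> word_code (letters S) ` lists (letters S)
      then mult_code S (pfst p)
        (if pfst (psnd p) = 0
         then mult_code S (f (psnd (psnd p))) (left_div_code S (pfst p) c)
         else left_div_code S (f (psnd (psnd p))) (left_div_code S (pfst p) c))
      else c)"

lemma computable_fun_conj_mult_code:
  assumes "finite S" "computable_fun f" "computable_fun a" "computable_fun b"
  shows "computable_fun (\<lambda>n. conj_mult_code S f (a n) (b n))"
proof -
  have "computable_fun (\<lambda>n. f (psnd (psnd (a n))))"
    using assms(2) by (rule computable_fun_comp) (intro computable_intros assms(3))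
  then show ?thesis
    unfolding conj_mult_code_def
    by (intro computable_fun_if_mem decidable_word_code_image_lists finite_cartesian_product
        finite_UNIV assms(1,3,4) computable_intros)
qed

theorem re_words_normal_closure:
  assumes "finite S" "R \<subseteq> carrier (free_group S)" "re_words (letters S) R"
  shows "re_words (letters S) (normal_closure (free_group S) R)"
proof -
  interpret group "free_group S" by (rule group_free_group)
  let ?F = "free_group S" and ?N = "normal_closure (free_group S) R"
  let ?code = "word_code (letters S)"
  interpret N: normal ?N ?F
    using assms(2) by (rule normal_normal_closure)
  \<comment> \<open>The code of the empty word is allowed as a value, so that a total
    \<open>f\<close> exists even when \<open>R\<close> is empty.\<close>
  obtain f where f: "computable_fun f" "?code ` R \<subseteq> range f" "range f \<subseteq> ?code ` insert [] R"
  proof (cases "R = {}")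
    case True
    then show ?thesis
      by (intro that[of "\<lambda>_. 0"]) (auto simp: computable_fun_const)
  next
    case False
    then obtain f where "computable_fun f" "?code ` R = range f"
      using assms(3) unfolding re_words_def re_set_def by auto
    then show ?thesis
      by (intro that[of f]) auto
  qed
  have N_lists: "u \<in> lists (letters S)" if "u \<in> carrier ?F" for u
    using carrier_free_groupD[OF that] by simp
  define act where "act g r u = (g \<otimes>\<^bsub>?F\<^esub> (r \<otimes>\<^bsub>?F\<^esub> (inv\<^bsub>?F\<^esub> g \<otimes>\<^bsub>?F\<^esub> u)))" for g r u
  have inv_eq: "foldr cancel_cons (rev (map flip w)) u = inv\<^bsub>?F\<^esub> (foldr cancel_cons w []) \<otimes>\<^bsub>?F\<^esub> u"
    if "w \<in> lists (letters S)" "u \<in> carrier ?F" for w u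
    using foldr_cancel_cons_eq_mult[OF that(2)] foldr_cancel_cons_rev_flip_eq_inv[OF that(1)] by simp
  \<comment> \<open>On codes of group elements one operation is left multiplication by a conjugate;
    the conjugator is the reduced form of \<open>w\<close>.\<close>
  have step: "conj_mult_code S f (prod_encode (?code w, prod_encode (b, i))) (?code u) =
      ?code (act (foldr cancel_cons w []) (if b = 0 then r else inv\<^bsub>?F\<^esub> r) u)"
    if w: "w \<in> lists (letters S)" and u: "u \<in> carrier ?F" and r: "r \<in> carrier ?F" "f i = ?code r"
    for w u r b i
  proof -
    let ?w = "foldr cancel_cons w []"
    have wc: "?w \<in> carrier ?F"
      using w by (simp add: foldr_cancel_cons_in_carrier)
    have d: "left_div_code S (?code w) (?code u) = ?code (inv\<^bsub>?F\<^esub> ?w \<otimes>\<^bsub>?F\<^esub> u)" 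
      using word_code_foldr_cancel_cons_rev_flip[OF assms(1) w N_lists[OF u]] inv_eq[OF w u] by simp
    let ?d = "inv\<^bsub>?F\<^esub> ?w \<otimes>\<^bsub>?F\<^esub> u"
    have dc: "?d \<in> carrier ?F"
      using wc u by simp
    have rr: "foldr cancel_cons r [] = r"
      using carrier_free_groupD[OF r(1)] by (intro foldr_cancel_cons_Nil) simp
    have e: "(if b = 0 then mult_code S (?code r) (?code ?d) else left_div_code S (?code r) (?code ?d))
        = ?code ((if b = 0 then r else inv\<^bsub>?F\<^esub> r) \<otimes>\<^bsub>?F\<^esub> ?d)"
      using word_code_foldr_cancel_cons[OF assms(1) N_lists[OF r(1)] N_lists[OF dc]]
        word_code_foldr_cancel_cons_rev_flip[OF assms(1) N_lists[OF r(1)] N_lists[OF dc]]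
        inv_eq[OF N_lists[OF r(1)] dc] foldr_cancel_cons_eq_mult[OF dc, of r]
      by (simp add: rr)
    let ?e = "(if b = 0 then r else inv\<^bsub>?F\<^esub> r) \<otimes>\<^bsub>?F\<^esub> ?d"
    have ec: "?e \<in> carrier ?F"
      using dc r(1) by simp
    have "mult_code S (?code w) (?code ?e) = ?code (?w \<otimes>\<^bsub>?F\<^esub> ?e)"
      using word_code_foldr_cancel_cons[OF assms(1) w N_lists[OF ec]]
        foldr_cancel_cons_eq_mult[OF ec, of w] by simp
    then show ?thesis
      using w e by (cases "b = 0") (simp_all add: conj_mult_code_def act_def r(2) d)
  qed
  \<comment> \<open>The start value \<open>0\<close> codes the identity. Every \<open>c\<close>
    codes a finite list of triples, so all finite products of conjugates of relators and their
    inverses occur.\<close>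
  define enum where "enum c = fold (conj_mult_code S f) (list_decode c) 0" for c
  have "computable_fun enum"
    unfolding enum_def by (intro computable_intros computable_fun_conj_mult_code assms(1) f(1))
  moreover have "range enum = ?code ` ?N"
  proof (intro equalityI subsetI)
    fix n assume "n \<in> range enum"
    then obtain ps where n: "n = fold (conj_mult_code S f) ps 0"
      unfolding enum_def by blast
    have "fold (conj_mult_code S f) ps (?code u) \<in> ?code ` ?N" if "u \<in> ?N" for u
      using that
    proof (induction ps arbitrary: u)
      case (Cons p ps)
      have "conj_mult_code S f p (?code u) \<in> ?code ` ?N"
      proof (cases "pfst p \<in> ?code ` lists (letters S)")
        case True
        then obtain w where w: "w \<in> lists (letters S)" "pfst p = ?code w"
          by blast
        obtain r where r: "r \<in> insert [] R" "f (psnd (psnd p)) = ?code r"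
          using f(3) by blast
        have rc: "r \<in> carrier ?F"
          using r(1) assms(2) by auto
        have p: "p = prod_encode (?code w, prod_encode (pfst (psnd p), psnd (psnd p)))"
          by (simp flip: w(2))
        let ?w = "foldr cancel_cons w []"
        have wc: "?w \<in> carrier ?F"
          using w(1) by (simp add: foldr_cancel_cons_in_carrier)
        have uc: "u \<in> carrier ?F"
          using Cons.prems N.subset by blast
        have "conj_mult_code S f p (?code u) =
            ?code (act ?w (if pfst (psnd p) = 0 then r else inv\<^bsub>?F\<^esub> r) u)"
          using step[OF w(1) uc rc r(2), of "pfst (psnd p)"] unfolding p[symmetric] .
        moreover have "act ?w (if pfst (psnd p) = 0 then r else inv\<^bsub>?F\<^esub> r) u \<in> ?N"
          using normal_closure_conj_mult[OF assms(2) wc _ Cons.prems, of r] r(1)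
          unfolding act_def by (cases "pfst (psnd p) = 0") simp_all
        ultimately show ?thesis
          by simp
      qed (use Cons.prems in \<open>simp add: conj_mult_code_def\<close>)
      then show ?case
        using Cons.IH by auto
    qed simp
    from this[OF N.one_closed] show "n \<in> ?code ` ?N"
      by (simp add: n)
  next
    fix n assume "n \<in> ?code ` ?N"
    then obtain u where u: "u \<in> ?N" "n = ?code u"
      by blast
    \<comment> \<open>Since \<open>fold\<close> processes entries from the left, a triple appended
      at the end multiplies the product so far on the left, as the induction below requires.\<close>
    have ext: "\<exists>ps. fold (conj_mult_code S f) ps 0 = ?code (act g r' u)"
      if ps: "fold (conj_mult_code S f) ps 0 = ?code u" and g: "g \<in> carrier ?F"
        and r: "r \<in> R" "r' \<in> {r, inv\<^bsub>?F\<^esub> r}" and u: "u \<in> ?N" for g r r' u ps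
    proof -
      obtain i where i: "f i = ?code r"
        using f(2) r(1) by fastforce
      define b :: nat where "b = (if r' = r then 0 else 1)"
      have "foldr cancel_cons g [] = g"
        using carrier_free_groupD[OF g] by (intro foldr_cancel_cons_Nil) simp
      then have "conj_mult_code S f (prod_encode (?code g, prod_encode (b, i))) (?code u)
          = ?code (act g r' u)"
        using step[OF N_lists[OF g] subsetD[OF N.subset u] subsetD[OF assms(2) r(1)] i, of b] r(2)
        by (cases "r' = r") (simp_all add: b_def)
      then show ?thesis
        by (intro exI[of _ "ps @ [prod_encode (?code g, prod_encode (b, i))]"]) (simp add: ps)
    qed
    have "\<exists>ps. fold (conj_mult_code S f) ps 0 = ?code u"
      using u(1) assms(2)
    proof (induction rule: normal_closure_left_induct)
      case one
      show ?case by (intro exI[of _ "[]"]) simp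
    next
      case (mult g r u)
      from mult(4) obtain ps where "fold (conj_mult_code S f) ps 0 = ?code u" ..
      from ext[OF this mult(1,2) _ mult(3), of r] show ?case
        by (simp add: act_def)
    next
      case (inv g r u)
      from inv(4) obtain ps where "fold (conj_mult_code S f) ps 0 = ?code u" ..
      from ext[OF this inv(1,2) _ inv(3), of "inv\<^bsub>?F\<^esub> r"] show ?case
        by (simp add: act_def)
    qed
    then obtain ps where "fold (conj_mult_code S f) ps 0 = n"
      using u(2) by blast
    then have "n = enum (list_encode ps)"
      by (simp add: enum_def)
    then show "n \<in> range enum"
      by (rule range_eqI)
  qed
  ultimately have "re_set (?code ` ?N)"
    unfolding re_set_def by metis
  moreover have "?N \<subseteq> lists (letters S)"
    using N.subset N_lists by (meson subsetD subsetI)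
  ultimately show ?thesis
    using assms(1) by (simp add: re_words_def)
qed

text \<open>The homomorphic extension of \<open>v\<close> to words, with values reduced in the free
  group. It serves both to lift words to a presentation and to rewrite words over another generating
  set.\<close>

definition substitute :: "('a \<Rightarrow> ('b \<times> bool) list) \<Rightarrow> 'a list \<Rightarrow> ('b \<times> bool) list" where
  "substitute v w = foldr (\<lambda>s. foldr cancel_cons (v s)) w []"

lemma substitute_Nil [simp]: "substitute v [] = []"
  and substitute_Cons [simp]: "substitute v (s # w) = foldr cancel_cons (v s) (substitute v w)"
  by (simp_all add: substitute_def)

lemma substitute_in_carrier:
  assumes "\<And>s. s \<in> S \<Longrightarrow> v s \<in> lists (letters T)" "w \<in> lists S"
  shows "substitute v w \<in> carrier (free_group T)"
  using assms(2)
proof induction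
  case (Cons s w)
  then show ?case
    by (simp only: substitute_Cons) (intro foldr_cancel_cons_in_carrier assms(1))
qed simp

text \<open>Only finitely many words \<open>v s\<close> occur, so their codes form a finite table
  \<open>V\<close>, and substitution is a \<open>foldr\<close> of multiplications on codes.\<close>

lemma computable_substitute:
  assumes "finite S" "finite T" "\<And>s. s \<in> S \<Longrightarrow> v s \<in> lists (letters T)"
  obtains h where "computable_fun h"
    "\<And>w. w \<in> lists S \<Longrightarrow> word_code (letters T) (substitute v w) = h (word_code S w)"
proof
  define V where "V k = (if k < card S then word_code (letters T) (v (from_nat_into S k)) else 0)" for k
  let ?h = "\<lambda>n. foldr (\<lambda>k. mult_code T (V k)) (list_decode n) 0"
  have V: "computable_fun V"
    by (rule computable_fun_finite[of "card S" _ 0]) (simp add: V_def)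
  show "computable_fun ?h"
    by (intro computable_intros computable_fun_comp[OF V])
  fix w assume "w \<in> lists S"
  then show "word_code (letters T) (substitute v w) = ?h (word_code S w)"
  proof induction
    case (Cons s w)
    have "V (to_nat_on S s) = word_code (letters T) (v s)"
      using to_nat_on_less_card[OF assms(1) Cons.hyps(1)] assms(1) Cons.hyps(1)
      by (simp add: V_def countable_finite)
    moreover have "substitute v w \<in> lists (letters T)"
      using substitute_in_carrier[of S v T w] assms(3) Cons.hyps(2) carrier_free_groupD by blast
    ultimately show ?case
      using Cons assms(2,3) by (simp add: word_code_foldr_cancel_cons)
  qed simp
qed

section \<open>Effective subshifts from semidecidable sets of words\<close>

lemma prod_decode_0 [simp]: "prod_decode 0 = (0, 0)"
  using prod_encode_inverse[of "(0, 0)"] by (simp add: prod_encode_def)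

text \<open>The tail of a coded list is \<open>psnd (c - 1)\<close>; this holds for the empty word
  too, because \<open>0\<close> decodes to \<open>(0, 0)\<close>.\<close>

lemma word_code_drop:
  "word_code A (drop k w) = rec_nat (word_code A w) (\<lambda>_ c. psnd (c - 1)) k"
proof (induction k)
  case (Suc k)
  have "psnd (word_code A u - 1) = word_code A (tl u)" for u
    by (cases u) auto
  then show ?case
    using Suc by (simp add: drop_Suc tl_drop del: One_nat_def flip: Suc)
qed simp

lemma factors_subset_lists: "x \<in> full_shift A \<Longrightarrow> factors x \<subseteq> lists A"
  by (auto simp: full_shift_def factors_def image_subset_iff)

lemma drop_in_factors:
  assumes "w \<in> factors x"
  shows "drop k w \<in> factors x"
proof -
  obtain i n where w: "w = map (\<lambda>j. x (i + int j)) [0..<n]"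
    using assms by (auto simp: factors_def)
  have "drop k w = map (\<lambda>j. x ((i + int k) + int j)) [0..<n - k]"
    unfolding w by (rule nth_equalityI) (auto simp: algebra_simps)
  then show ?thesis
    unfolding factors_def by blast
qed

text \<open>Configurations are infinite to the left, so the window may start as early as
  desired.\<close>

lemma factors_extend_left:
  assumes "u \<in> factors x" "length u \<le> m"
  obtains w where "w \<in> factors x" "length w = m" "drop (m - length u) w = u"
proof -
  obtain i n where u: "u = map (\<lambda>j. x (i + int j)) [0..<n]"
    using assms by (auto simp: factors_def)
  let ?w = "map (\<lambda>j. x ((i + int n - int m) + int j)) [0..<m]"
  show thesis
  proof (rule that)
    show "?w \<in> factors x"
      unfolding factors_def by blast
    show "drop (m - length u) ?w = u"
      using assms(2) unfolding u
      by (intro nth_equalityI) (auto simp: of_nat_diff algebra_simps)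
  qed simp
qed

text \<open>The equation \<open>a (word_code A w) = b c\<close> expresses semidecidability, with
  \<open>c\<close> as the witness of an unbounded search.\<close>

lemma effective_subshift_semidecidable:
  assumes "finite A" "computable_fun a" "computable_fun b"
  shows "effective_subshift A
    (avoiding_shift A {w \<in> lists A. w \<noteq> [] \<and> (\<exists>c. a (word_code A w) = b c)})"
proof -
  define W where "W = {w \<in> lists A. w \<noteq> [] \<and> (\<exists>c. a (word_code A w) = b c)}"
  \<comment> \<open>Here \<open>p\<close> codes a pair of a suffix length minus one and a witness.
    Bounding \<open>p\<close> by the length of the word makes the search finite.\<close>
  define F where "F = {w \<in> lists A. \<exists>p<length w.
    a (word_code A (drop (length w - Suc (pfst p)) w)) = b (psnd p)}"
  define len where "len n = fold (\<lambda>_. Suc) (list_decode n) 0" for n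
  define rest where "rest k n = rec_nat n (\<lambda>_ c. psnd (c - 1)) k" for k n :: nat
  define Q where "Q n p \<longleftrightarrow> a (rest (len n - Suc (pfst p)) n) = b (psnd p)" for n p
  have "fold (\<lambda>_. Suc) ks m = m + length ks" for ks :: "nat list" and m
    by (induction ks arbitrary: m) auto
  then have len: "len (word_code A w) = length w" for w
    by (simp add: len_def word_code_def)
  have F: "w \<in> F \<longleftrightarrow> w \<in> lists A \<and> (\<exists>p<len (word_code A w). Q (word_code A w) p)" for w
    by (simp add: F_def Q_def len word_code_drop rest_def)
  \<comment> \<open>A bounded search is a recursion on its bound.\<close>
  have "rec_nat 0 (\<lambda>p r. if P p then 1 else r) m = (if \<exists>p<m. P p then 1 else (0::nat))" for P m
    by (induction m) (auto simp: less_Suc_eq)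
  moreover have "word_code A ` F = {n \<in> word_code A ` lists A. \<exists>p<len n. Q n p}"
    using F by blast
  ultimately have "(if n \<in> word_code A ` F then 1 else 0) =
    (if n \<in> word_code A ` lists A then rec_nat 0 (\<lambda>p r. if Q n p then 1 else r) (len n)
     else (0::nat))" for n
    by simp
  moreover have "computable_fun (\<lambda>n. if n \<in> word_code A ` lists A
      then rec_nat 0 (\<lambda>p r. if Q n p then 1 else r) (len n) else 0)"
    unfolding Q_def len_def rest_def
    by (intro computable_fun_if_mem decidable_word_code_image_lists assms(1) computable_intros
        computable_fun_comp[OF assms(2)] computable_fun_comp[OF assms(3)])
  ultimately have "decidable_set (word_code A ` F)"
    unfolding decidable_set_def by (simp only:)
  moreover have "F \<subseteq> lists A"
    unfolding F_def by blast
  ultimately have dec: "decidable_words A F"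
    using assms(1) by (simp add: decidable_words_def)
  have "factors x \<inter> F = {} \<longleftrightarrow> factors x \<inter> W = {}" if x: "x \<in> full_shift A" for x
  proof -
    have "\<exists>w. w \<in> factors x \<inter> F" if u: "u \<in> factors x" "u \<in> W" for u
    proof -
      obtain c where c: "a (word_code A u) = b c" and "u \<noteq> []"
        using u(2) by (auto simp: W_def)
      \<comment> \<open>Extending \<open>u\<close> to length \<open>Suc p\<close> makes
        \<open>p\<close> admissible in the search; \<open>u\<close> fits because a pair code is at
        least its first component.\<close>
      define p where "p = prod_encode (length u - 1, c)"
      have pu: "Suc (pfst p) = length u"
        using \<open>u \<noteq> []\<close> by (simp add: p_def)
      moreover have "length u \<le> Suc p"
        using le_prod_encode_1[of "length u - 1" c] by (simp add: p_def)
      ultimately obtain w where w: "w \<in> factors x" "length w = Suc p" "drop (Suc p - length u) w = u"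
        using factors_extend_left[OF u(1)] by metis
      have "a (word_code A (drop (length w - Suc (pfst p)) w)) = b (psnd p)"
        unfolding w(2) pu w(3) c by (simp add: p_def)
      moreover have "w \<in> lists A"
        using w(1) factors_subset_lists[OF x] by blast
      moreover have "p < length w"
        using w(2) by simp
      ultimately have "w \<in> F"
        unfolding F_def by blast
      then show ?thesis
        using w(1) by blast
    qed
    moreover have "\<exists>u. u \<in> factors x \<inter> W" if w: "w \<in> factors x" "w \<in> F" for w
    proof -
      obtain p where p: "p < length w"
          "a (word_code A (drop (length w - Suc (pfst p)) w)) = b (psnd p)"
        using w(2) by (auto simp: F_def)
      let ?u = "drop (length w - Suc (pfst p)) w"
      have u: "?u \<in> factors x"
        using w(1) by (rule drop_in_factors)
      \<comment> \<open>From \<open>p < length w\<close> the word \<open>w\<close> is nonempty, and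
        the \<open>Suc\<close> keeps at least its last letter.\<close>
      moreover have "?u \<noteq> []"
        using p(1) by auto
      moreover have "?u \<in> lists A"
        using u factors_subset_lists[OF x] by (rule subsetD[rotated])
      ultimately show ?thesis
        using p(2) by (auto simp: W_def simp del: in_lists_conv_set)
    qed
    ultimately show ?thesis
      by blast
  qed
  then have "avoiding_shift A W = avoiding_shift A F"
    unfolding avoiding_shift_def by (intro Collect_cong conj_cong refl) simp
  with dec show ?thesis
    unfolding effective_subshift_def W_def[symmetric] by blast
qed

section \<open>The word problem and the skeleton\<close>

lemma word_value_Nil [simp]: "word_value G [] = \<one>\<^bsub>G\<^esub>"
  and word_value_Cons [simp]: "word_value G (s # w) = s \<otimes>\<^bsub>G\<^esub> word_value G w"
  by (simp_all add: word_value_def)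

lemma (in group) word_value_closed: "w \<in> lists (carrier G) \<Longrightarrow> word_value G w \<in> carrier G"
  by (induction w) auto

lemma (in group) word_value_append:
  "u \<in> lists (carrier G) \<Longrightarrow> w \<in> lists (carrier G) \<Longrightarrow>
    word_value G (u @ w) = word_value G u \<otimes> word_value G w"
  by (induction u) (auto simp: m_assoc word_value_closed)

text \<open>Each \<open>s\<close> is lifted to a free group element \<open>v s\<close> representing
  its image in the presented group. A word is trivial exactly when its lift lies in the normal
  closure: \<open>a\<close> computes the code of the lift and \<open>b\<close> enumerates the codes
  of the closure.\<close>

lemma (in group) word_problem_semidecidable:
  assumes "recursively_presented G" "finite S" "S \<subseteq> carrier G"
  obtains a b where "computable_fun a" "computable_fun b"
    "\<And>w. w \<in> lists S \<Longrightarrow> word_value G w = \<one> \<longleftrightarrow> (\<exists>c. a (word_code S w) = b c)"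
proof -
  obtain T :: "nat set" and R where T: "finite T" and R: "R \<subseteq> carrier (free_group T)"
      "re_words (letters T) R" and iso: "G \<cong> presented_group T R"
    using assms(1) unfolding recursively_presented_def by blast
  let ?F = "free_group T" and ?code = "word_code (letters T)"
  let ?N = "normal_closure ?F R"
  interpret F: group ?F by (rule group_free_group)
  interpret N: normal ?N ?F
    using R(1) by (rule F.normal_normal_closure)
  interpret Q: group "?F Mod ?N" by (rule N.factorgroup_is_group)
  obtain h where h: "h \<in> iso G (?F Mod ?N)"
    using iso unfolding is_iso_def presented_group_def by blast
  then interpret h: group_hom G "?F Mod ?N" h
    by unfold_locales (simp add: iso_def)
  have "\<exists>u\<in>carrier ?F. ?N #>\<^bsub>?F\<^esub> u = h s" if "s \<in> S" for s
  proof -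
    have "h s \<in> carrier (?F Mod ?N)"
      using that assms(3) by (intro h.hom_closed) blast
    then show ?thesis
      by (auto simp: carrier_FactGroup)
  qed
  then obtain v where v: "\<And>s. s \<in> S \<Longrightarrow> v s \<in> carrier ?F" "\<And>s. s \<in> S \<Longrightarrow> ?N #>\<^bsub>?F\<^esub> v s = h s"
    by metis
  have v_lists: "v s \<in> lists (letters T)" if "s \<in> S" for s
    using carrier_free_groupD[OF v(1)[OF that]] by simp
  have sub: "substitute v w \<in> carrier ?F" if "w \<in> lists S" for w
    using that by (intro substitute_in_carrier[of S] v_lists)
  have "h (word_value G w) = ?N #>\<^bsub>?F\<^esub> substitute v w" if "w \<in> lists S" for w
    using that
  proof induction
    case Nil
    show ?case using h.hom_one N.subset by (simp add: F.coset_mult_one[of ?N, simplified])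
  next
    case (Cons s w)
    have "word_value G w \<in> carrier G"
      using Cons.hyps(2) assms(3) by (intro word_value_closed) auto
    moreover have "s \<in> carrier G"
      using Cons.hyps(1) assms(3) by blast
    ultimately have "h (word_value G (s # w)) = (?N #>\<^bsub>?F\<^esub> v s) <#>\<^bsub>?F\<^esub> (?N #>\<^bsub>?F\<^esub> substitute v w)"
      using Cons v(2) by simp
    also have "\<dots> = ?N #>\<^bsub>?F\<^esub> (v s \<otimes>\<^bsub>?F\<^esub> substitute v w)"
      using Cons.hyps by (intro N.rcos_sum v(1) sub)
    also have "v s \<otimes>\<^bsub>?F\<^esub> substitute v w = substitute v (s # w)"
      by (simp add: free_group_def)
    finally show ?case .
  qed
  \<comment> \<open>The identity of the quotient is the coset \<open>?N\<close> itself, and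
    \<open>h\<close> is injective.\<close>
  moreover have "word_value G w = \<one> \<longleftrightarrow> h (word_value G w) = ?N" if "w \<in> lists S" for w
  proof -
    have "inj_on h (carrier G)"
      using h by (simp add: iso_def bij_betw_def)
    moreover have "word_value G w \<in> carrier G"
      using that assms(3) by (intro word_value_closed) auto
    ultimately have "h (word_value G w) = h \<one> \<longleftrightarrow> word_value G w = \<one>"
      by (rule inj_on_eq_iff) (rule one_closed)
    then show ?thesis
      unfolding h.hom_one one_FactGroup by blast
  qed
  ultimately have iff: "word_value G w = \<one> \<longleftrightarrow> substitute v w \<in> ?N" if "w \<in> lists S" for w
    using that F.coset_join1[OF _ sub[OF that] N.subgroup_axioms]
      F.coset_join2[OF sub[OF that] N.subgroup_axioms] by metis
  obtain a where a: "computable_fun a" "\<And>w. w \<in> lists S \<Longrightarrow> ?code (substitute v w) = a (word_code S w)"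
    using computable_substitute[OF assms(2) T, of v] v_lists by blast
  have re: "re_words (letters T) ?N"
    using T R by (rule re_words_normal_closure)
  moreover have "?code ` ?N \<noteq> {}"
    using N.one_closed by blast
  ultimately obtain b where b: "computable_fun b" "?code ` ?N = range b"
    unfolding re_words_def re_set_def by blast
  show ?thesis
  proof (rule that[OF a(1) b(1)])
    fix w assume w: "w \<in> lists S"
    have "countable (letters T)"
      using T by (simp add: countable_finite)
    moreover have "substitute v w \<in> lists (letters T)"
      using carrier_free_groupD[OF sub[OF w]] by blast
    moreover have "?N \<subseteq> lists (letters T)"
      using re unfolding re_words_def by blast
    ultimately have "?code (substitute v w) \<in> ?code ` ?N \<longleftrightarrow> substitute v w \<in> ?N"
      by (rule inj_on_image_mem_iff[OF inj_on_word_code])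
    then show "word_value G w = \<one> \<longleftrightarrow> (\<exists>c. a (word_code S w) = b c)"
      unfolding iff[OF w] a(2)[OF w] b(2) by blast
  qed
qed

text \<open>Factors of a configuration over \<open>S\<close> are words over \<open>S\<close>, so
  restricting the forbidden words to \<open>lists S\<close> loses nothing.\<close>

lemma skeleton_eq_avoiding_shift:
  "skeleton G S = avoiding_shift S {w \<in> lists S. w \<noteq> [] \<and> word_value G w = \<one>\<^bsub>G\<^esub>}"
  using factors_subset_lists unfolding skeleton_def avoiding_shift_def by fast

lemma (in group) effective_subshift_skeleton:
  assumes "recursively_presented G" "finite S" "S \<subseteq> carrier G"
  shows "effective_subshift S (skeleton G S)"
proof -
  obtain a b where ab: "computable_fun a" "computable_fun b"
    "\<And>w. w \<in> lists S \<Longrightarrow> word_value G w = \<one> \<longleftrightarrow> (\<exists>c. a (word_code S w) = b c)"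
    using word_problem_semidecidable[OF assms] by blast
  then have "skeleton G S =
      avoiding_shift S {w \<in> lists S. w \<noteq> [] \<and> (\<exists>c. a (word_code S w) = b c)}"
    unfolding skeleton_eq_avoiding_shift by (metis (no_types, lifting))
  then show ?thesis
    using effective_subshift_semidecidable[OF assms(2) ab(1,2)] by simp
qed

section \<open>Projection from the free group and computable configurations\<close>

lemma free_proj_Nil [simp]: "free_proj G [] = \<one>\<^bsub>G\<^esub>"
  and free_proj_Cons [simp]: "free_proj G (x # w) =
    (if snd x then fst x else inv\<^bsub>G\<^esub> (fst x)) \<otimes>\<^bsub>G\<^esub> free_proj G w"
  by (simp_all add: free_proj_def split_beta)

context group
begin

lemma free_proj_closed:
  "T \<subseteq> carrier G \<Longrightarrow> w \<in> lists (letters T) \<Longrightarrow> free_proj G w \<in> carrier G"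
  by (induction w) auto

lemma free_proj_cancel_cons:
  assumes "T \<subseteq> carrier G" "x \<in> letters T" "w \<in> lists (letters T)"
  shows "free_proj G (cancel_cons x w) = free_proj G (x # w)"
proof (cases w)
  case (Cons y u)
  have "free_proj G u \<in> carrier G"
    using assms Cons by (intro free_proj_closed[of T]) auto
  then show ?thesis
    using assms Cons by (auto simp: flip_def m_assoc[symmetric])
qed simp

lemma free_proj_foldr_cancel_cons:
  assumes "T \<subseteq> carrier G" "u \<in> lists (letters T)" "w \<in> lists (letters T)"
  shows "free_proj G (foldr cancel_cons u w) = free_proj G u \<otimes> free_proj G w"
  using assms(2)
proof induction
  case Nil
  then show ?case using free_proj_closed[OF assms(1,3)] by simp
next
  case (Cons x u)
  have "fst x \<in> carrier G" "free_proj G u \<in> carrier G" "free_proj G w \<in> carrier G"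
    using Cons assms free_proj_closed[OF assms(1)] by auto
  moreover have "foldr cancel_cons u w \<in> lists (letters T)"
    using Cons assms(3) by (intro foldr_cancel_cons_in_lists)
  ultimately show ?case
    using Cons assms free_proj_cancel_cons[of T x "foldr cancel_cons u w"]
    by (simp add: m_assoc)
qed

text \<open>Rewrites words over \<open>S\<close> as elements of the free group on \<open>T\<close>
  without changing their value in the group.\<close>

lemma free_proj_substitute:
  assumes "T \<subseteq> carrier G" "w \<in> lists S"
    and "\<And>s. s \<in> S \<Longrightarrow> v s \<in> lists (letters T)" "\<And>s. s \<in> S \<Longrightarrow> free_proj G (v s) = s"
  shows "free_proj G (substitute v w) = word_value G w"
  using assms(2)
proof induction
  case (Cons s w)
  have "substitute v w \<in> lists (letters T)"
    using substitute_in_carrier[of S v T w] assms(3) Cons.hyps(2) carrier_free_groupD by blast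
  then show ?case
    using Cons assms by (simp add: free_proj_foldr_cancel_cons[of T])
qed simp

lemma free_proj_surj:
  assumes "T \<subseteq> carrier G" "g \<in> generate G T"
  shows "\<exists>w\<in>lists (letters T). free_proj G w = g"
  using assms(2,1)
proof (induction rule: generate_left_induct)
  case one
  show ?case by (rule bexI[of _ "[]"]) auto
next
  case (mult h u)
  then obtain w where "w \<in> lists (letters T)" "free_proj G w = u" by blast
  then show ?case using mult(1) by (intro bexI[of _ "(h, True) # w"]) auto
next
  case (inv h u)
  then obtain w where "w \<in> lists (letters T)" "free_proj G w = u" by blast
  then show ?case using inv(1) by (intro bexI[of _ "(h, False) # w"]) auto
qed

text \<open>The generating set \<open>T\<close> supplied by algorithmic finiteness may differ from
  \<open>S\<close>, so the words read off \<open>x\<close> are first rewritten over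
  \<open>T\<close>.\<close>

lemma not_computable_config_skeleton:
  assumes "algorithmically_finite G" "finite S" "S \<subseteq> carrier G" "x \<in> skeleton G S"
  shows "\<not> computable_config S x"
proof
  assume comp: "computable_config S x"
  obtain T where T: "generating_set G T" "algorithmically_finite_wrt G T"
    using assms(1) unfolding algorithmically_finite_def by blast
  have T': "finite T" "T \<subseteq> carrier G" "generate G T = carrier G"
    using T(1) by (auto simp: generating_set_def)
  obtain v where v: "\<And>s. s \<in> S \<Longrightarrow> v s \<in> lists (letters T)" "\<And>s. s \<in> S \<Longrightarrow> free_proj G (v s) = s"
    using free_proj_surj[OF T'(2)] T'(3) assms(3) by (metis subsetD)
  have x: "x i \<in> S" for i
    using assms(4) by (auto simp: skeleton_def full_shift_def)
  \<comment> \<open>These words end just before position \<open>0\<close> and grow to the left, so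
    each arises from the previous one by a single cons, which is easy on list codes.\<close>
  define w where "w n = map (\<lambda>j. x (int j - int n)) [0..<n]" for n
  have w_lists: "w n \<in> lists S" for n
    by (auto simp: w_def x)
  have w_Suc: "w (Suc n) = x (- 1 - int n) # w n" for n
    by (rule nth_equalityI) (auto simp: w_def nth_Cons algebra_simps simp del: upt_Suc split: nat.split)
  have distinct: "word_value G (w m) \<noteq> word_value G (w n)" if "m < n" for m n
  proof -
    \<comment> \<open>The surplus prefix of \<open>w n\<close> over \<open>w m\<close> is a nonempty
      factor of \<open>x\<close>, hence has nontrivial value; cancelling \<open>w m\<close>
      separates the two values.\<close>
    define u where "u = map (\<lambda>j. x (- int n + int j)) [0..<n - m]"
    have "u \<in> factors x"
      unfolding u_def factors_def by blast
    moreover have "u \<noteq> []"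
      using that by (simp add: u_def)
    ultimately have "word_value G u \<noteq> \<one>"
      using assms(4) by (auto simp: skeleton_def)
    moreover have "w n = u @ w m"
      by (rule nth_equalityI) (use that in \<open>auto simp: w_def u_def nth_append of_nat_diff algebra_simps\<close>)
    moreover have "u \<in> lists (carrier G)" "w m \<in> lists (carrier G)"
      using subsetD[OF assms(3) x] by (auto simp: u_def w_def)
    ultimately show ?thesis
      using word_value_append[of u "w m"] word_value_closed[of u] word_value_closed[of "w m"]
        r_cancel_one' by metis
  qed
  define L where "L n = substitute v (w n)" for n
  have L: "L n \<in> carrier (free_group T)" for n
    unfolding L_def using w_lists v(1) by (intro substitute_in_carrier[of S])
  have proj: "free_proj G (L n) = word_value G (w n)" for n
    unfolding L_def using w_lists v by (intro free_proj_substitute[OF T'(2), of _ S])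
  \<comment> \<open>This gives both that \<open>range L\<close> is infinite and that it contains no
    pair of distinct words with the same projection.\<close>
  have proj_inj: "m = n" if "free_proj G (L m) = free_proj G (L n)" for m n
    using that distinct[of m n] distinct[of n m] by (metis proj nat_neq_iff)
  then have "inj L"
    by (metis injI)
  then have "infinite (range L)"
    using finite_imageD infinite_UNIV_nat by blast
  moreover have "re_words (letters T) (range L)"
  proof -
    obtain a where a: "computable_fun a"
        "\<And>u. u \<in> lists S \<Longrightarrow> word_code (letters T) (substitute v u) = a (word_code S u)"
      using computable_substitute[OF assms(2) T'(1), of v] v(1) by blast
    let ?x = "\<lambda>n. to_nat_on S (x (int_decode n))"
    \<comment> \<open>Negative integers have odd codes; this locates the letter prepended when
      passing from \<open>w n\<close> to \<open>w (Suc n)\<close>.\<close>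
    have "int_decode (Suc (n + n)) = - 1 - int n" for n
    proof -
      have "int_encode (- 1 - int n) = Suc (n + n)"
        by (simp add: int_encode_def sum_encode_def)
      then show ?thesis
        by (metis int_encode_inverse)
    qed
    then have "word_code S (w n) = rec_nat 0 (\<lambda>y r. Suc (prod_encode (?x (Suc (y + y)), r))) n" for n
      by (induction n) (simp_all add: w_Suc, simp add: w_def)
    then have code: "word_code (letters T) (L n) =
        a (rec_nat 0 (\<lambda>y r. Suc (prod_encode (?x (Suc (y + y)), r))) n)" for n
      using a(2)[OF w_lists] by (simp add: L_def)
    have x_comp: "computable_fun ?x"
      using comp by (simp add: computable_config_def)
    have "computable_fun (\<lambda>n. a (rec_nat 0 (\<lambda>y r. Suc (prod_encode (?x (Suc (y + y)), r))) n))"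
      by (intro computable_fun_comp[OF a(1)] computable_intros computable_fun_comp[OF x_comp])
    then have "computable_fun (\<lambda>n. word_code (letters T) (L n))"
      unfolding code .
    then have "re_set (word_code (letters T) ` range L)"
      unfolding re_set_def image_image by blast
    moreover have "range L \<subseteq> lists (letters T)"
      using L carrier_free_groupD by blast
    ultimately show ?thesis
      using T'(1) by (simp add: re_words_def)
  qed
  ultimately have "infinite {(u, v). u \<in> range L \<and> v \<in> range L \<and> u \<noteq> v \<and> free_proj G u = free_proj G v}"
    using T(2) L unfolding algorithmically_finite_wrt_def by blast
  moreover have "{(u, v). u \<in> range L \<and> v \<in> range L \<and> u \<noteq> v \<and> free_proj G u = free_proj G v} = {}"
    using proj_inj by blast
  ultimately show False
    by (metis finite.emptyI)
qed

end

theorem proposition4p15: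
  fixes G :: "('a, 'b) monoid_scheme" and S :: "'a set"
  assumes "Dehn_monster G"
    and "generating_set G S"
  shows "effective_subshift S (skeleton G S) \<and>
         (\<forall>x \<in> skeleton G S. \<not> computable_config S x)"
proof -
  interpret group G
    using assms(1) by (simp add: Dehn_monster_def)
  have "recursively_presented G" "algorithmically_finite G" "finite S" "S \<subseteq> carrier G"
    using assms by (simp_all add: Dehn_monster_def generating_set_def)
  then show ?thesis
    by (intro conjI ballI effective_subshift_skeleton not_computable_config_skeleton)
qed

end
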